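(* Let $G$ be a graph and let $H$ be an attachment set of $G$. Then $$\eta(\mathfrak{a}(G,H))\ge \eta(G).$$
   Context: All graphs are finite and simple (not necessarily connected). The nullity $\eta(G)$ of a graph $G$ is $\dim\ker A(G)$, where $A(G)$ is the (real) adjacency matrix of $G$. An attachment set of $G$ is a cyclic $h$-tuple $H=(v_1,\dots,v_h)$ of vertices of $G$ with $h\ge 2$, in which a vertex may occur more than once. The altan $\mathfrak{a}(G,H)$ is the pair $(G',H')$, where $G'$ is the graph with vertex set $V(G')=V(G)\sqcup\{x_1,\dots,x_h\}\sqcup\{y_1,\dots,y_h\}$ (disjoint union, all $x_i$, $y_i$ being new distinct vertices) and edge set $E(G')=E(G)\sqcup\{v_ix_i,\,x_iy_i : 1\le i\le h\}\sqcup\{y_ix_{i+1} : 1\le i<h\}\sqcup\{y_hx_1\}$, and $H'=(y_1,\dots,y_h)$ is the induced attachment set. The nullity of a pair means the nullity of its graph, so $\eta(\mathfrak{a}(G,H))=\eta(G')$. *)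

theory Defs
  imports Complex_Main "HOL-Library.Function_Algebras"
begin

record 'a sgraph =
  verts :: "'a set"
  edges :: "'a set set"

definition simple_graph :: "'a sgraph \<Rightarrow> bool" where
  "simple_graph G \<longleftrightarrow>
     finite (verts G) \<and> (\<forall>e\<in>edges G. e \<subseteq> verts G \<and> card e = 2)"

text \<open>Matrices and vectors are indexed by the vertices themselves, so that no enumeration of
  the vertex set has to be chosen. A vector indexed by the vertex set of a graph is a function
  on the vertex type that vanishes outside that set; addition of functions is pointwise
  (\<^theory>\<open>HOL-Library.Function_Algebras\<close>).\<close>

definition adj_matrix :: "'a sgraph \<Rightarrow> 'a \<Rightarrow> 'a \<Rightarrow> real" where
  "adj_matrix G u v = (if {u, v} \<in> edges G then 1 else 0)"

definition adj_kernel :: "'a sgraph \<Rightarrow> ('a \<Rightarrow> real) set" where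
  "adj_kernel G =
     {f. (\<forall>v. v \<notin> verts G \<longrightarrow> f v = 0) \<and>
         (\<forall>u\<in>verts G. (\<Sum>v\<in>verts G. adj_matrix G u v * f v) = 0)}"

global_interpretation real_fun: vector_space "\<lambda>(c::real) (f::'a \<Rightarrow> real) v. c * f v"
  by unfold_locales (auto simp: fun_eq_iff algebra_simps)

definition nullity :: "'a sgraph \<Rightarrow> nat" where
  "nullity G = real_fun.dim (adj_kernel G)"

text \<open>A cyclic tuple is given by a list, i.e. by one of its linear representatives.\<close>

definition attachment_set :: "'a sgraph \<Rightarrow> 'a list \<Rightarrow> bool" where
  "attachment_set G H \<longleftrightarrow> length H \<ge> 2 \<and> set H \<subseteq> verts G"

datatype 'a altan_vertex = Old 'a | X nat | Y nat

definition altan :: "'a sgraph \<Rightarrow> 'a list \<Rightarrow> 'a altan_vertex sgraph \<times> 'a altan_vertex list" where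
  "altan G H =
     (let h = length H in
       (\<lparr> verts = Old ` verts G \<union> X ` {..<h} \<union> Y ` {..<h},
          edges = (\<lambda>e. Old ` e) ` edges G
            \<union> {{Old (H ! i), X i} | i. i < h}
            \<union> {{X i, Y i} | i. i < h}
            \<union> {{Y i, X (Suc i)} | i. Suc i < h}
            \<union> {{Y (h - 1), X 0}} \<rparr>,
        map Y [0..<h]))"

lemma subspace_adj_kernel: "real_fun.subspace (adj_kernel G)"
  by (auto simp: real_fun.subspace_def adj_kernel_def algebra_simps sum.distrib
      simp flip: sum_distrib_left)

text \<open>The dimension in \<open>nullity\<close> is a genuine one, not a default value for spaces of infinite
  dimension.\<close>

lemma finite_basis_adj_kernel:
  assumes "simple_graph G"
  obtains B where "finite B" "real_fun.independent B" "real_fun.span B = adj_kernel G"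
    "card B = nullity G"
proof -
  obtain B where B: "B \<subseteq> adj_kernel G" "real_fun.independent B"
      "adj_kernel G \<subseteq> real_fun.span B" "card B = real_fun.dim (adj_kernel G)"
    using real_fun.basis_exists by blast
  define d :: "'a \<Rightarrow> 'a \<Rightarrow> real" where "d = (\<lambda>u v. if v = u then 1 else 0)"
  have fin: "finite (verts G)" using assms by (simp add: simple_graph_def)
  have "f \<in> real_fun.span (d ` verts G)" if f: "f \<in> adj_kernel G" for f
  proof -
    have sum_at: "(\<Sum>u\<in>A. g u) v = (\<Sum>u\<in>A. g u v)"
      if "finite A" for A :: "'a set" and g :: "'a \<Rightarrow> 'a \<Rightarrow> real" and v
      using that by induction auto
    have "f = (\<Sum>u\<in>verts G. (\<lambda>v. f u * d u v))"
      using f fin by (auto simp: fun_eq_iff sum_at d_def adj_kernel_def if_distrib cong: if_cong)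
    also have "\<dots> \<in> real_fun.span (d ` verts G)"
      by (intro real_fun.span_sum real_fun.span_scale real_fun.span_base) auto
    finally show ?thesis .
  qed
  then have "finite B"
    using real_fun.independent_span_bound[of "d ` verts G" B] B fin by auto
  moreover have "real_fun.span B = adj_kernel G"
    using B real_fun.span_minimal[OF B(1) subspace_adj_kernel] by blast
  ultimately show ?thesis using that B by (simp add: nullity_def)
qed

lemma altan_well_formed:
  assumes "simple_graph G" "attachment_set G H"
  shows "simple_graph (fst (altan G H))" "attachment_set (fst (altan G H)) (snd (altan G H))"
proof -
  have "card (Old ` e) = 2" if "e \<in> edges G" for e
    using assms that by (simp add: simple_graph_def card_image inj_on_def)
  then show "simple_graph (fst (altan G H))"
    using assms nth_mem
    by (fastforce simp: simple_graph_def attachment_set_def altan_def Let_def)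
  show "attachment_set (fst (altan G H)) (snd (altan G H))"
    using assms by (auto simp: attachment_set_def altan_def Let_def)
qed

end

theory Submission imports Defs begin

text \<open>Delete from the linear system \<open>A(G') g = 0\<close> of the altan \<open>G'\<close> the single equation at the
  vertex \<open>X 0\<close>. Deleting one equation enlarges the solution space by at most one dimension
  (\<open>card_independent_le_Suc_nullity\<close>), so it suffices to find \<open>\<eta>(G) + 1\<close> independent solutions of
  the remaining system. Every kernel vector \<open>f\<close> of \<open>G\<close> and every real \<open>t\<close> give one: keep \<open>f\<close> on
  \<open>G\<close>, put \<open>0\<close> on all \<open>X i\<close> and \<open>t\<close> on \<open>Y 0\<close>. Then the equations at the vertices of \<open>G\<close> and at
  the \<open>Y i\<close> hold, and the equation at \<open>X (Suc i)\<close>, whose neighbours are \<open>H ! Suc i\<close>, \<open>Y i\<close> and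
  \<open>Y (Suc i)\<close>, determines the value on \<open>Y (Suc i)\<close> from the one on \<open>Y i\<close>. The only equation that
  could fail is the one that closes the cycle, which is the deleted one. The extension is linear
  and injective in the pair \<open>(f, t)\<close>, which ranges over a space of dimension \<open>\<eta>(G) + 1\<close>
  (\<open>independent_altan_extensions\<close>).

  Cutting the cycle open in this way avoids a case distinction on the parity of the length
  of \<open>H\<close>, on which the solvability of the closing equation for a given \<open>f\<close> depends.\<close>

section \<open>Kernel vectors up to one equation\<close>

definition kernel_except :: "'a sgraph \<Rightarrow> 'a \<Rightarrow> ('a \<Rightarrow> real) set" where
  "kernel_except G x =
     {f. (\<forall>v. v \<notin> verts G \<longrightarrow> f v = 0) \<and>
         (\<forall>u\<in>verts G - {x}. (\<Sum>v\<in>verts G. adj_matrix G u v * f v) = 0)}"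

lemma subspace_kernel_except: "real_fun.subspace (kernel_except G x)"
  by (auto simp: real_fun.subspace_def kernel_except_def algebra_simps sum.distrib
      simp flip: sum_distrib_left)

text \<open>A vector that violates the omitted equation spans, together with the kernel, the whole
  solution space of the others: subtracting a suitable multiple of it repairs the omitted
  equation for any other solution.\<close>

lemma card_independent_le_Suc_nullity:
  assumes "simple_graph G" and indep: "real_fun.independent S" and S: "S \<subseteq> kernel_except G x"
  shows "card S \<le> Suc (nullity G)"
proof -
  obtain C where C: "finite C" "real_fun.span C = adj_kernel G" "card C = nullity G"
    using finite_basis_adj_kernel[OF assms(1)] by metis
  define L where "L f = (\<Sum>v\<in>verts G. adj_matrix G x v * f v)" for f
  have kernelI: "f \<in> adj_kernel G" if "f \<in> kernel_except G x" "L f = 0" for f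
    using that by (auto simp: kernel_except_def adj_kernel_def L_def)
  have "\<exists>w. S \<subseteq> real_fun.span (insert w C)"
  proof (cases "\<forall>s\<in>S. L s = 0")
    case True
    then have "S \<subseteq> real_fun.span C"
      using S kernelI C(2) by blast
    then show ?thesis
      using real_fun.span_mono[OF subset_insertI] by blast
  next
    case False
    then obtain w where w: "w \<in> S" "L w \<noteq> 0" by blast
    have "s \<in> real_fun.span (insert w C)" if s: "s \<in> S" for s
    proof -
      define k where "k = L s / L w"
      have "s - (\<lambda>v. k * w v) \<in> kernel_except G x"
        using s w S subspace_kernel_except
        by (intro real_fun.subspace_diff real_fun.subspace_scale) auto
      moreover have "L (s - (\<lambda>v. k * w v)) = L s - k * L w"
        by (simp add: L_def algebra_simps sum_subtractf sum_distrib_left)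
      ultimately have "s - (\<lambda>v. k * w v) \<in> real_fun.span C"
        using kernelI w C(2) by (simp add: k_def)
      then show ?thesis
        using real_fun.span_breakdown_eq by blast
    qed
    then show ?thesis by blast
  qed
  then obtain w where "S \<subseteq> real_fun.span (insert w C)" ..
  then have "card S \<le> card (insert w C)"
    using real_fun.independent_span_bound indep C(1) by blast
  also have "\<dots> \<le> Suc (nullity G)"
    using C(1,3) by (simp add: card_insert_if)
  finally show ?thesis .
qed

section \<open>The adjacency sums of the altan\<close>

lemma sum_verts_altan:
  fixes F :: "'a altan_vertex \<Rightarrow> real"
  assumes "simple_graph G"
  shows "(\<Sum>v\<in>verts (fst (altan G H)). F v) =
    (\<Sum>a\<in>verts G. F (Old a)) + (\<Sum>i<length H. F (X i)) + (\<Sum>i<length H. F (Y i))"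
proof -
  have "finite (verts G)" using assms by (simp add: simple_graph_def)
  moreover have "(Old ` verts G \<union> X ` {..<length H}) \<inter> Y ` {..<length H} = {}"
    "Old ` verts G \<inter> X ` {..<length H} = {}"
    by auto
  ultimately show ?thesis
    by (simp add: altan_def Let_def sum.union_disjoint sum.reindex inj_on_def)
qed

lemma adj_matrix_altan_Old_Old:
  "adj_matrix (fst (altan G H)) (Old a) (Old b) = adj_matrix G a b"
proof -
  have "{Old a, Old b} = Old ` e \<longleftrightarrow> {a, b} = e" for e
    using inj_image_eq_iff[of Old "{a, b}" e] by (simp add: inj_on_def)
  then show ?thesis
    by (auto simp: adj_matrix_def altan_def Let_def image_iff doubleton_eq_iff)
qed

lemma adj_matrix_altan_Old_Y: "adj_matrix (fst (altan G H)) (Old a) (Y j) = 0"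
  by (auto simp: adj_matrix_def altan_def Let_def image_iff doubleton_eq_iff)

lemma adj_matrix_altan_Y_Old: "adj_matrix (fst (altan G H)) (Y j) (Old a) = 0"
  using adj_matrix_altan_Old_Y[of G H a j] by (simp add: adj_matrix_def insert_commute)

lemma adj_matrix_altan_Y_Y: "adj_matrix (fst (altan G H)) (Y i) (Y j) = 0"
  by (auto simp: adj_matrix_def altan_def Let_def image_iff doubleton_eq_iff)

lemma adj_matrix_altan_X_Old:
  assumes "i < length H"
  shows "adj_matrix (fst (altan G H)) (X i) (Old a) = (if a = H ! i then 1 else 0)"
  using assms by (auto simp: adj_matrix_def altan_def Let_def image_iff doubleton_eq_iff)

lemma adj_matrix_altan_X_Suc_Y:
  assumes "Suc i < length H"
  shows "adj_matrix (fst (altan G H)) (X (Suc i)) (Y j) =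
    (if j = i then 1 else 0) + (if j = Suc i then 1 else 0)"
  using assms by (auto simp: adj_matrix_def altan_def Let_def image_iff doubleton_eq_iff)

section \<open>Extending kernel vectors to the altan\<close>

text \<open>The recursion is the equation at \<open>X (Suc i)\<close>, solved for the value on \<open>Y (Suc i)\<close>.\<close>

primrec Y_value :: "'a list \<Rightarrow> ('a \<Rightarrow> real) \<Rightarrow> real \<Rightarrow> nat \<Rightarrow> real" where
  "Y_value H f t 0 = t"
| "Y_value H f t (Suc i) = - f (H ! Suc i) - Y_value H f t i"

definition altan_extension :: "'a list \<Rightarrow> ('a \<Rightarrow> real) \<Rightarrow> real \<Rightarrow> 'a altan_vertex \<Rightarrow> real" where
  "altan_extension H f t v =
     (case v of Old a \<Rightarrow> f a | X i \<Rightarrow> 0 | Y i \<Rightarrow> if i < length H then Y_value H f t i else 0)"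

lemma altan_extension_simps [simp]:
  "altan_extension H f t (Old a) = f a"
  "altan_extension H f t (X i) = 0"
  "altan_extension H f t (Y i) = (if i < length H then Y_value H f t i else 0)"
  by (simp_all add: altan_extension_def)

lemma altan_extension_in_kernel_except:
  assumes G: "simple_graph G" and H: "attachment_set G H" and f: "f \<in> adj_kernel G"
  shows "altan_extension H f t \<in> kernel_except (fst (altan G H)) (X 0)"
proof -
  let ?A = "adj_matrix (fst (altan G H))" and ?g = "altan_extension H f t"
  have fin: "finite (verts G)" using G by (simp add: simple_graph_def)
  have verts: "verts (fst (altan G H)) = Old ` verts G \<union> X ` {..<length H} \<union> Y ` {..<length H}"
    by (simp add: altan_def Let_def)
  have "?g v = 0" if "v \<notin> verts (fst (altan G H))" for v
    using that f by (cases v) (auto simp: verts adj_kernel_def)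
  moreover have "(\<Sum>v\<in>verts (fst (altan G H)). ?A u v * ?g v) = 0"
    if u: "u \<in> verts (fst (altan G H)) - {X 0}" for u
  proof (cases u)
    case (Old a)
    then have "a \<in> verts G" using u by (auto simp: verts)
    then show ?thesis
      using f Old
      by (simp add: sum_verts_altan[OF G] adj_matrix_altan_Old_Old adj_matrix_altan_Old_Y
          adj_kernel_def)
  next
    case (X j)
    then obtain i where i: "u = altan_vertex.X (Suc i)" "Suc i < length H"
      using u X by (cases j) (auto simp: verts)
    then have "H ! Suc i \<in> verts G"
      using H nth_mem by (fastforce simp: attachment_set_def)
    then have "(\<Sum>a\<in>verts G. (if a = H ! Suc i then 1 else 0) * f a) = f (H ! Suc i)"
      using fin by (simp add: if_distrib[of "\<lambda>c. c * _"] cong: if_cong)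
    moreover have "(\<Sum>j<length H. ((if j = i then 1 else 0) + (if j = Suc i then 1 else 0)) *
        Y_value H f t j) = Y_value H f t i + Y_value H f t (Suc i)"
      using i(2) by (simp add: distrib_right sum.distrib if_distrib[of "\<lambda>c. c * _"]
          del: Y_value.simps cong: if_cong)
    ultimately show ?thesis
      using i by (simp add: sum_verts_altan[OF G] adj_matrix_altan_X_Old adj_matrix_altan_X_Suc_Y)
  next
    case (Y i)
    then show ?thesis
      by (simp add: sum_verts_altan[OF G] adj_matrix_altan_Y_Old adj_matrix_altan_Y_Y)
  qed
  ultimately show ?thesis by (simp add: kernel_except_def)
qed

lemma Y_value_add:
  "Y_value H (f + g) (s + t) i = Y_value H f s i + Y_value H g t i"
  by (induction i) auto

lemma Y_value_scale: "Y_value H (\<lambda>a. c * f a) (c * t) i = c * Y_value H f t i"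
  by (induction i) (auto simp: algebra_simps)

lemma altan_extension_add:
  "altan_extension H (f + g) (s + t) = altan_extension H f s + altan_extension H g t"
  by (auto simp: fun_eq_iff altan_extension_def Y_value_add split: altan_vertex.split)

lemma altan_extension_scale:
  "altan_extension H (\<lambda>a. c * f a) (c * t) = (\<lambda>v. c * altan_extension H f t v)"
  by (auto simp: fun_eq_iff altan_extension_def Y_value_scale split: altan_vertex.split)

global_interpretation real_fun_pair:
  vector_space_pair "\<lambda>(c::real) (f::'a \<Rightarrow> real) v. c * f v" "\<lambda>(c::real) (f::'b \<Rightarrow> real) v. c * f v"
  by unfold_locales

text \<open>The values on \<open>G\<close> recover \<open>f\<close>, and the value on \<open>Y 0\<close> is \<open>t\<close>: extensions with \<open>t = 0\<close> form
  a copy of the kernel in which everything vanishes on \<open>Y 0\<close>, so the extension of the zero vector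
  with \<open>t = 1\<close> is independent of them.\<close>

lemma independent_altan_extensions:
  assumes "H \<noteq> []" and B: "real_fun.independent B" "finite B"
  defines "S \<equiv> insert (altan_extension H 0 1) ((\<lambda>f. altan_extension H f 0) ` B)"
  shows "real_fun.independent S" and "card S = Suc (card B)"
proof -
  let ?E = "\<lambda>f. altan_extension H f 0" and ?e = "altan_extension H 0 1"
  have lin: "Vector_Spaces.linear (\<lambda>(c::real) (f::'a \<Rightarrow> real) v. c * f v)
      (\<lambda>(c::real) (f::'a altan_vertex \<Rightarrow> real) v. c * f v) ?E"
    using altan_extension_add[of H _ _ 0 0] altan_extension_scale[of H _ _ 0]
    by unfold_locales auto
  have inj: "inj ?E"
  proof (rule injI)
    fix f g assume "?E f = ?E g"
    then have "?E f (Old a) = ?E g (Old a)" for a by simp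
    then show "f = g" by (simp add: fun_eq_iff)
  qed
  have "real_fun.independent (?E ` B)"
    by (rule real_fun_pair.linear_independent_injective_image[OF lin B(1)
          inj_on_subset[OF inj subset_UNIV]])
  moreover have notin: "?e \<notin> real_fun.span (?E ` B)"
  proof
    have "real_fun.subspace {g. g (Y 0) = 0}"
      by (auto simp: real_fun.subspace_def)
    moreover have "?E ` B \<subseteq> {g. g (Y 0) = 0}" by auto
    ultimately have "real_fun.span (?E ` B) \<subseteq> {g. g (Y 0) = 0}"
      by (intro real_fun.span_minimal)
    moreover assume "?e \<in> real_fun.span (?E ` B)"
    ultimately have "?e \<in> {g. g (Y 0) = 0}" by (rule subsetD)
    then show False using assms(1) by simp
  qed
  ultimately show "real_fun.independent S"
    unfolding S_def by (rule real_fun.independent_insertI[rotated])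
  have "?e \<notin> ?E ` B" using notin real_fun.span_superset[of "?E ` B"] by (meson subsetD)
  moreover have "card (?E ` B) = card B"
    by (rule card_image[OF inj_on_subset[OF inj subset_UNIV]])
  ultimately show "card S = Suc (card B)"
    unfolding S_def using B(2) by (metis card_insert_disjoint finite_imageI)
qed

theorem theorem6:
  fixes G :: "'a sgraph" and H :: "'a list"
  assumes "simple_graph G" and "attachment_set G H"
  shows "nullity (fst (altan G H)) \<ge> nullity G"
proof -
  obtain B where B: "finite B" "real_fun.independent B" "real_fun.span B = adj_kernel G"
      "card B = nullity G"
    using finite_basis_adj_kernel[OF assms(1)] by metis
  define S where "S = insert (altan_extension H 0 1) ((\<lambda>f. altan_extension H f 0) ` B)"
  have "H \<noteq> []" using assms(2) by (auto simp: attachment_set_def)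
  from independent_altan_extensions[OF this B(2,1)]
  have S: "real_fun.independent S" "card S = Suc (nullity G)"
    unfolding S_def B(4) .
  have "B \<subseteq> adj_kernel G" "0 \<in> adj_kernel G"
    unfolding B(3)[symmetric] by (rule real_fun.span_superset real_fun.span_zero)+
  then have "S \<subseteq> kernel_except (fst (altan G H)) (X 0)"
    using altan_extension_in_kernel_except[OF assms] by (auto simp: S_def)
  then have "card S \<le> Suc (nullity (fst (altan G H)))"
    by (rule card_independent_le_Suc_nullity[OF altan_well_formed(1)[OF assms] S(1)])
  then show ?thesis using S(2) by simp
qed

end
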